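(* Let $p_1,p_2,p_3,n\in\mathbb{Z}^{+}$, let $P_2^3=(p_1,p_2,-p_3)$ be an oriented pretzel link, and let $\mathbb{Z}_n$ be the dihedral quandle. Put $P=p_1p_2-p_1p_3-p_2p_3$, $Q=\gcd(p_1,p_2,p_3)$, $D_1=\gcd(Q,n)$ and $D_2=\gcd\left(\frac{|P|}{Q},n\right)$. Then the coloring number of $P_2^3$ is $$|\mathrm{Hom}(\mathcal{Q}(P_2^3),\mathbb{Z}_n)|=\begin{cases} n & \text{if } \gcd(P,n)=1,\\ D_1D_2\,n & \text{otherwise.}\end{cases}$$
   Context: A quandle is a set $X$ with a binary operation $\triangleright$ such that $x\triangleright x=x$ for all $x$; for each $y$ the map $x\mapsto x\triangleright y$ is invertible; and $(x\triangleright y)\triangleright z=(x\triangleright z)\triangleright(y\triangleright z)$ for all $x,y,z$. A quandle homomorphism $f$ satisfies $f(x\triangleright y)=f(x)\triangleright f(y)$. The dihedral quandle $\mathbb{Z}_n$ is the set of integers modulo $n$ with $x\triangleright y=2y-x \pmod n$. For an oriented link $K$ with diagram $D$, the fundamental quandle $\mathcal{Q}(K)$ is the quandle generated by the arcs of $D$ with one relation per crossing: if the overcrossing arc is $y$ (pointing up), and $x$ is the undercrossing arc on the right of $y$, then the undercrossing arc on the left of $y$ is $x\triangleright y$. $\mathrm{Hom}(\mathcal{Q}(K),X)$ is the set of quandle homomorphisms (colorings of $K$ by $X$); its cardinality is the coloring number of $K$ (with respect to $X$). Pretzel link: for nonzero integers $p_1,\dots,p_m$, the pretzel link $(p_1,\dots,p_m)$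 is formed from $m$ tangles $A_1,\dots,A_m$ placed side by side, where $A_i$ is a vertical column of two strands twisted about each other with $|p_i|$ crossings, all of one fixed handedness if $p_i>0$ ("positive") and all of the opposite handedness if $p_i<0$ ("negative"). The NE endpoint of $A_i$ is joined to the NW endpoint of $A_{i+1}$, the SE endpoint of $A_i$ to the SW endpoint of $A_{i+1}$, and the outer endpoints are closed up by joining the NW (resp. SW) endpoint of $A_1$ to the NE (resp. SE) endpoint of $A_m$. Any orientation of the link may be chosen. Convention: $\gcd(0,n)=n$. *)

theory Defs
  imports "HOL-Library.FuncSet"
begin

record 'a qstruct =
  qcarrier :: "'a set"
  qop :: "'a \<Rightarrow> 'a \<Rightarrow> 'a"

definition quandle :: "'a qstruct \<Rightarrow> bool" where
  "quandle X \<longleftrightarrow>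
     (\<forall>x\<in>qcarrier X. \<forall>y\<in>qcarrier X. qop X x y \<in> qcarrier X) \<and>
     (\<forall>x\<in>qcarrier X. qop X x x = x) \<and>
     (\<forall>y\<in>qcarrier X. bij_betw (\<lambda>x. qop X x y) (qcarrier X) (qcarrier X)) \<and>
     (\<forall>x\<in>qcarrier X. \<forall>y\<in>qcarrier X. \<forall>z\<in>qcarrier X.
        qop X (qop X x y) z = qop X (qop X x z) (qop X y z))"

text \<open>Homomorphisms are extensional outside the carrier, so that the cardinality of this set
  counts maps defined on the carrier only.\<close>

definition quandle_Hom :: "'a qstruct \<Rightarrow> 'b qstruct \<Rightarrow> ('a \<Rightarrow> 'b) set" where
  "quandle_Hom X Y =
     {f \<in> qcarrier X \<rightarrow>\<^sub>E qcarrier Y.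
        \<forall>x\<in>qcarrier X. \<forall>y\<in>qcarrier X. f (qop X x y) = qop Y (f x) (f y)}"

definition dihedral_quandle :: "int \<Rightarrow> int qstruct" where
  "dihedral_quandle n = \<lparr>qcarrier = {0..<n}, qop = (\<lambda>x y. (2 * y - x) mod n)\<rparr>"

lemma quandle_dihedral: "quandle (dihedral_quandle n)"
proof -
  have "bij_betw (\<lambda>x. (2 * y - x) mod n) {0..<n} {0..<n}" for y
  proof (rule bij_betw_byWitness[where f' = "\<lambda>x. (2 * y - x) mod n"])
    have inv: "(2 * y - (2 * y - x) mod n) mod n = x" if "x \<in> {0..<n}" for x
      using that by (simp add: mod_diff_right_eq)
    show "\<forall>x\<in>{0..<n}. (2 * y - (2 * y - x) mod n) mod n = x"
      and "\<forall>x\<in>{0..<n}. (2 * y - (2 * y - x) mod n) mod n = x"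
      using inv by blast+
  qed auto
  moreover have "(2 * z - (2 * y - x) mod n) mod n
      = (2 * ((2 * z - y) mod n) - (2 * z - x) mod n) mod n" for x y z
  proof -
    have "(2 * ((2 * z - y) mod n) - (2 * z - x) mod n) mod n
        = (2 * (2 * z - y) - (2 * z - x)) mod n"
      by (metis mod_diff_left_eq mod_diff_right_eq mod_mult_right_eq)
    then show ?thesis
      by (simp add: mod_diff_right_eq algebra_simps)
  qed
  ultimately show ?thesis
    by (auto simp: quandle_def dihedral_quandle_def)
qed


section \<open>Quandles given by generators and relations\<close>

text \<open>\<open>QInv s t\<close> stands for the preimage of \<open>s\<close> under right translation by \<open>t\<close>.\<close>

datatype (qgens: 'a) qterm =
    QGen 'a
  | QOp "'a qterm" "'a qterm"
  | QInv "'a qterm" "'a qterm"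

definition qterms :: "'a set \<Rightarrow> 'a qterm set" where
  "qterms A = {t. qgens t \<subseteq> A}"

inductive_set qcong :: "'a set \<Rightarrow> ('a qterm \<times> 'a qterm) set \<Rightarrow> ('a qterm \<times> 'a qterm) set"
  for A R where
  rel: "(s, t) \<in> R \<Longrightarrow> s \<in> qterms A \<Longrightarrow> t \<in> qterms A \<Longrightarrow> (s, t) \<in> qcong A R"
| idem: "t \<in> qterms A \<Longrightarrow> (QOp t t, t) \<in> qcong A R"
| inv_op: "s \<in> qterms A \<Longrightarrow> t \<in> qterms A \<Longrightarrow> (QInv (QOp s t) t, s) \<in> qcong A R"
| op_inv: "s \<in> qterms A \<Longrightarrow> t \<in> qterms A \<Longrightarrow> (QOp (QInv s t) t, s) \<in> qcong A R"
| distrib: "s \<in> qterms A \<Longrightarrow> t \<in> qterms A \<Longrightarrow> u \<in> qterms A \<Longrightarrow>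
    (QOp (QOp s t) u, QOp (QOp s u) (QOp t u)) \<in> qcong A R"
| refl: "t \<in> qterms A \<Longrightarrow> (t, t) \<in> qcong A R"
| sym: "(s, t) \<in> qcong A R \<Longrightarrow> (t, s) \<in> qcong A R"
| trans: "(s, t) \<in> qcong A R \<Longrightarrow> (t, u) \<in> qcong A R \<Longrightarrow> (s, u) \<in> qcong A R"
| op_cong: "(s, s') \<in> qcong A R \<Longrightarrow> (t, t') \<in> qcong A R \<Longrightarrow>
    (QOp s t, QOp s' t') \<in> qcong A R"
| inv_cong: "(s, s') \<in> qcong A R \<Longrightarrow> (t, t') \<in> qcong A R \<Longrightarrow>
    (QInv s t, QInv s' t') \<in> qcong A R"

definition presented_quandle ::
    "'a set \<Rightarrow> ('a qterm \<times> 'a qterm) set \<Rightarrow> 'a qterm set qstruct" where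
  "presented_quandle A R =
     \<lparr>qcarrier = qterms A // qcong A R,
      qop = (\<lambda>c d. \<Union>s\<in>c. \<Union>t\<in>d. qcong A R `` {QOp s t})\<rparr>"

lemma qterms_simps [simp]:
  "QGen a \<in> qterms A \<longleftrightarrow> a \<in> A"
  "QOp s t \<in> qterms A \<longleftrightarrow> s \<in> qterms A \<and> t \<in> qterms A"
  "QInv s t \<in> qterms A \<longleftrightarrow> s \<in> qterms A \<and> t \<in> qterms A"
  by (auto simp: qterms_def)

lemma qcong_qterms:
  "(s, t) \<in> qcong A R \<Longrightarrow> s \<in> qterms A \<and> t \<in> qterms A"
  by (induction rule: qcong.induct) auto

lemma equiv_qcong: "equiv (qterms A) (qcong A R)"
proof (rule equivI)
  show "qcong A R \<subseteq> qterms A \<times> qterms A"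
    using qcong_qterms by fastforce
  show "refl_on (qterms A) (qcong A R)"
    by (auto intro!: refl_onI qcong.refl)
  show "sym_on UNIV (qcong A R)"
    by (rule symI) (rule qcong.sym)
  show "trans_on UNIV (qcong A R)"
    by (rule transI) (rule qcong.trans)
qed

lemma qop_presented_quandle:
  assumes "s \<in> qterms A" "t \<in> qterms A"
  shows "qop (presented_quandle A R) (qcong A R `` {s}) (qcong A R `` {t})
           = qcong A R `` {QOp s t}"
proof -
  have "congruent2 (qcong A R) (qcong A R) (\<lambda>s t. qcong A R `` {QOp s t})"
    by (rule congruent2I[OF equiv_qcong equiv_qcong])
      (auto intro!: equiv_class_eq[OF equiv_qcong] qcong.op_cong qcong.refl)
  then show ?thesis
    using UN_equiv_class2[OF equiv_qcong equiv_qcong _ assms]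
    by (simp add: presented_quandle_def)
qed

lemma quandle_presented_quandle: "quandle (presented_quandle A R)"
proof -
  let ?Q = "presented_quandle A R"
  let ?C = "\<lambda>t. qcong A R `` {t}"
  have carrier: "qcarrier ?Q = ?C ` qterms A"
    by (auto simp: presented_quandle_def quotient_def)
  note eqI = equiv_class_eq[OF equiv_qcong]
  note op = qop_presented_quandle
  have "bij_betw (\<lambda>x. qop ?Q x (?C t)) (?C ` qterms A) (?C ` qterms A)"
    if t: "t \<in> qterms A" for t
  proof (rule bij_betw_imageI)
    show "inj_on (\<lambda>x. qop ?Q x (?C t)) (?C ` qterms A)"
    proof (rule inj_onI, clarify)
      fix r s assume r: "r \<in> qterms A" and s: "s \<in> qterms A"
        and "qop ?Q (?C r) (?C t) = qop ?Q (?C s) (?C t)"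
      then have "(QOp r t, QOp s t) \<in> qcong A R"
        using r s t by (simp add: op eq_equiv_class_iff[OF equiv_qcong])
      then have "(QInv (QOp r t) t, QInv (QOp s t) t) \<in> qcong A R"
        using t by (intro qcong.inv_cong qcong.refl)
      then have "(r, s) \<in> qcong A R"
        using r s t by (meson qcong.inv_op qcong.sym qcong.trans)
      then show "?C r = ?C s" by (rule eqI)
    qed
    have "\<exists>r\<in>qterms A. ?C s = qop ?Q (?C r) (?C t)" if s: "s \<in> qterms A" for s
    proof
      show "QInv s t \<in> qterms A" using s t by simp
      show "?C s = qop ?Q (?C (QInv s t)) (?C t)"
        using s t by (simp add: op eqI[OF qcong.op_inv])
    qed
    then show "(\<lambda>x. qop ?Q x (?C t)) ` ?C ` qterms A = ?C ` qterms A"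
      using t by (auto simp: op image_iff)
  qed
  then show ?thesis
    unfolding quandle_def carrier
    by (simp add: op eq_equiv_class_iff[OF equiv_qcong] qcong.idem qcong.distrib)
qed


section \<open>Oriented link diagrams and the fundamental quandle\<close>

text \<open>A diagram is cut into edges. A crossing records the two edges of the overcrossing strand
  (incoming and outgoing) and the edges of the undercrossing strand lying to the right and to the
  left of the oriented overcrossing strand; the orientation of the undercrossing strand does not
  enter the relation. A join is a pair of edges glued at a point that is not a crossing.\<close>

record 'e crossing =
  over_in :: 'e
  over_out :: 'e
  under_right :: 'e
  under_left :: 'e

record 'e diagram =
  edges :: "'e set"
  joins :: "('e \<times> 'e) set"
  crossings :: "'e crossing set"

text \<open>An arc runs on through joins and overcrossings and is broken at undercrossings only.\<close>

definition same_arc :: "'e diagram \<Rightarrow> ('e \<times> 'e) set" where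
  "same_arc D =
     (let r = joins D \<union> (\<lambda>c. (over_in c, over_out c)) ` crossings D
      in (r \<union> r\<inverse>)\<^sup>*)"

definition arc_of :: "'e diagram \<Rightarrow> 'e \<Rightarrow> 'e set" where
  "arc_of D e = same_arc D `` {e}"

definition arcs :: "'e diagram \<Rightarrow> 'e set set" where
  "arcs D = arc_of D ` edges D"

definition crossing_relation ::
    "'e diagram \<Rightarrow> 'e crossing \<Rightarrow> 'e set qterm \<times> 'e set qterm" where
  "crossing_relation D c =
     (QGen (arc_of D (under_left c)),
      QOp (QGen (arc_of D (under_right c))) (QGen (arc_of D (over_in c))))"

definition fundamental_quandle :: "'e diagram \<Rightarrow> 'e set qterm set qstruct" where
  "fundamental_quandle D = presented_quandle (arcs D) (crossing_relation D ` crossings D)"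


section \<open>Pretzel links\<close>

text \<open>The edge \<open>(i, k, s)\<close> lies in the \<open>i\<close>-th column (counted from 0, left to right), on side
  \<open>s\<close>, just below the first \<open>k\<close> crossings of that column counted from the top. Crossing \<open>k\<close> of
  column \<open>i\<close> thus meets \<open>(i, k, Lft)\<close> at NW, \<open>(i, k, Rgt)\<close> at NE, \<open>(i, Suc k, Lft)\<close> at SW and
  \<open>(i, Suc k, Rgt)\<close> at SE; its two strands are NW--SE and NE--SW.\<close>

datatype side = Lft | Rgt

type_synonym pedge = "nat \<times> nat \<times> side"

definition ncross :: "int list \<Rightarrow> nat \<Rightarrow> nat" where
  "ncross ps i = nat \<bar>ps ! i\<bar>"

definition pretzel_edges :: "int list \<Rightarrow> pedge set" where
  "pretzel_edges ps = {(i, k, s). i < length ps \<and> k \<le> ncross ps i}"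

text \<open>The case \<open>i = length ps - 1\<close> is the outer closure.\<close>

definition pretzel_joins :: "int list \<Rightarrow> (pedge \<times> pedge) set" where
  "pretzel_joins ps =
     (\<Union>i<length ps. let j = Suc i mod length ps in
        {((i, 0, Rgt), (j, 0, Lft)), ((i, ncross ps i, Rgt), (j, ncross ps j, Lft))})"

text \<open>An orientation assigns to each edge whether it is traversed downwards. It is preserved along
  both strands of a crossing and, since every join is a cap or a cup, reversed across joins.\<close>

definition pretzel_orientation :: "int list \<Rightarrow> (pedge \<Rightarrow> bool) \<Rightarrow> bool" where
  "pretzel_orientation ps down \<longleftrightarrow>
     (\<forall>i<length ps. \<forall>k<ncross ps i.
        down (i, k, Lft) = down (i, Suc k, Rgt) \<and> down (i, k, Rgt) = down (i, Suc k, Lft)) \<and>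
     (\<forall>(e, e')\<in>pretzel_joins ps. down e \<noteq> down e')"

text \<open>The flag \<open>h\<close> is the choice of the handedness called positive: if it is true, then in positive
  columns the NE--SW strand is over at every crossing and in negative columns the NW--SE strand
  is; if it is false, the other way round.\<close>

definition pretzel_crossing ::
    "bool \<Rightarrow> int list \<Rightarrow> (pedge \<Rightarrow> bool) \<Rightarrow> nat \<Rightarrow> nat \<Rightarrow> pedge crossing" where
  "pretzel_crossing h ps down i k =
     (let nw = (i, k, Lft); ne = (i, k, Rgt); sw = (i, Suc k, Lft); se = (i, Suc k, Rgt) in
      if (ps ! i > 0) = h
      then (if down ne
        then \<lparr>over_in = ne, over_out = sw, under_right = nw, under_left = se\<rparr>
        else \<lparr>over_in = sw, over_out = ne, under_right = se, under_left = nw\<rparr>)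
      else (if down nw
        then \<lparr>over_in = nw, over_out = se, under_right = sw, under_left = ne\<rparr>
        else \<lparr>over_in = se, over_out = nw, under_right = ne, under_left = sw\<rparr>))"

definition pretzel_diagram :: "bool \<Rightarrow> int list \<Rightarrow> (pedge \<Rightarrow> bool) \<Rightarrow> pedge diagram" where
  "pretzel_diagram h ps down =
     \<lparr>edges = pretzel_edges ps,
      joins = pretzel_joins ps,
      crossings = {pretzel_crossing h ps down i k |i k. i < length ps \<and> k < ncross ps i}\<rparr>"

end

theory Submission imports Defs "HOL-Number_Theory.Cong" begin

text \<open>
  A homomorphism from a quandle given by generators and relations is the same thing as an assignment
  of values to the generators that respects the relations. For the fundamental quandle of a diagram
  the generators are arcs, so homomorphisms to \<open>X\<close> amount to colorings of the edges by elements of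
  \<open>X\<close> that are constant along arcs and satisfy the relation of each crossing
  (\<open>card_Hom_fundamental_quandle\<close>).

  In a dihedral quandle the crossing relation is the linear congruence saying that twice the color
  of the over strand is the sum of the colors of the two under edges. Hence going down a twisted
  column, the difference \<open>d\<close> between the right and the left color never changes, and each crossing
  adds \<open>d\<close> to both colors or subtracts it from both, according to the handedness. So the colors
  \<open>a\<^sub>1, \<dots>, a\<^sub>m\<close> at the upper left corners of the columns determine everything. The upper joins merely
  identify the right color of a column with the left color of the next one; the lower joins demand
  that the total drift \<open>p\<^sub>i (a\<^bsub>i+1\<^esub> - a\<^sub>i)\<close> modulo \<open>n\<close> be the same in every column
  (\<open>card_pretzel_colorings\<close>).

  For three columns with twists \<open>p, q, r\<close> the color \<open>a\<^sub>1\<close> is free, and the differences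
  \<open>x = a\<^sub>2 - a\<^sub>1\<close>, \<open>y = a\<^sub>3 - a\<^sub>2\<close> solve two homogeneous linear congruences, since the third difference is
  \<open>- (x + y)\<close>. The number of solutions modulo \<open>n\<close> of such a \<open>2 \<times> 2\<close> system with determinant \<open>\<Delta>\<close> and
  greatest common divisor \<open>Q\<close> of the coefficients is \<open>gcd(\<Delta>, n Q, n\<^sup>2)\<close>
  (\<open>card_homogeneous_system\<close>). Here \<open>\<Delta> = P\<close>. Since \<open>Q\<^sup>2\<close> divides \<open>P\<close>, which
  is a sum of products of two of the twists, \<open>Q\<close> divides \<open>P / Q\<close>, and the number of solutions equals
  \<open>gcd(Q, n) gcd(P / Q, n)\<close> (\<open>gcd_invariant_factors\<close>): the two invariant factors of the system enter
  separately. Both factors are \<open>1\<close> when \<open>gcd(P, n) = 1\<close>, because both \<open>Q\<close> and \<open>P / Q\<close> divide \<open>P\<close>.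
\<close>

section \<open>Homomorphisms from a presented quandle\<close>

text \<open>Evaluation of a term under an assignment of the generators; since right translations of a quandle
  are bijective, \<open>inv_into\<close> picks the only possible value for \<open>QInv\<close>.\<close>

primrec qeval :: "'b qstruct \<Rightarrow> ('a \<Rightarrow> 'b) \<Rightarrow> 'a qterm \<Rightarrow> 'b" where
  "qeval X g (QGen a) = g a"
| "qeval X g (QOp s t) = qop X (qeval X g s) (qeval X g t)"
| "qeval X g (QInv s t) =
     inv_into (qcarrier X) (\<lambda>x. qop X x (qeval X g t)) (qeval X g s)"

definition generator_assignments ::
    "'a set \<Rightarrow> ('a qterm \<times> 'a qterm) set \<Rightarrow> 'b qstruct \<Rightarrow> ('a \<Rightarrow> 'b) set" where
  "generator_assignments A R X =
     {g \<in> A \<rightarrow>\<^sub>E qcarrier X. \<forall>(s, t)\<in>R. qeval X g s = qeval X g t}"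

context
  fixes X :: "'b qstruct"
  assumes X: "quandle X"
begin

lemma qop_closed: "x \<in> qcarrier X \<Longrightarrow> y \<in> qcarrier X \<Longrightarrow> qop X x y \<in> qcarrier X"
  using X by (simp add: quandle_def)

lemma qop_distrib:
  "x \<in> qcarrier X \<Longrightarrow> y \<in> qcarrier X \<Longrightarrow> z \<in> qcarrier X \<Longrightarrow>
    qop X (qop X x y) z = qop X (qop X x z) (qop X y z)"
  using X unfolding quandle_def by blast

lemma qop_bij: "y \<in> qcarrier X \<Longrightarrow> bij_betw (\<lambda>x. qop X x y) (qcarrier X) (qcarrier X)"
  using X by (simp add: quandle_def)

lemma qeval_closed:
  assumes g: "g \<in> A \<rightarrow> qcarrier X"
  shows "t \<in> qterms A \<Longrightarrow> qeval X g t \<in> qcarrier X"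
proof (induction t)
  case (QInv s t)
  then have s: "qeval X g s \<in> qcarrier X" and t: "qeval X g t \<in> qcarrier X" by auto
  show ?case
    using bij_betw_apply[OF bij_betw_inv_into[OF qop_bij[OF t]] s] by simp
qed (use g in \<open>auto simp: qop_closed\<close>)

text \<open>Every rule generating the congruence is a law of quandles, a given relation, or a rule of
  equational logic, so evaluation is well defined on congruence classes.\<close>

lemma qeval_qcong:
  assumes g: "g \<in> A \<rightarrow> qcarrier X" and R: "\<forall>(s, t)\<in>R. qeval X g s = qeval X g t"
  shows "(s, t) \<in> qcong A R \<Longrightarrow> qeval X g s = qeval X g t"
proof (induction rule: qcong.induct)
  case (rel s t)
  then show ?case using R by auto
next
  case (idem t)
  then show ?case using X qeval_closed[OF g] by (simp add: quandle_def)
next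
  case (inv_op s t)
  then show ?case
    using bij_betw_inv_into_left[OF qop_bij[OF qeval_closed[OF g]]] qeval_closed[OF g] by simp
next
  case (op_inv s t)
  then show ?case
    using bij_betw_inv_into_right[OF qop_bij[OF qeval_closed[OF g]]] qeval_closed[OF g] by simp
next
  case (distrib s t u)
  then show ?case using qeval_closed[OF g] by (simp only: qeval.simps) (intro qop_distrib)
qed auto

text \<open>A homomorphism is determined by the images of the generators. The value at \<open>QInv s t\<close> is forced
  because acting on it by \<open>t\<close> gives the value at \<open>s\<close>, and this action is injective.\<close>

lemma Hom_eq_qeval:
  assumes f: "f \<in> quandle_Hom (presented_quandle A R) X"
  shows "t \<in> qterms A \<Longrightarrow>
    f (qcong A R `` {t}) = qeval X (\<lambda>a\<in>A. f (qcong A R `` {QGen a})) t"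
proof (induction t)
  case (QOp s t)
  have C: "qcong A R `` {r} \<in> qcarrier (presented_quandle A R)" if "r \<in> qterms A" for r
    using that by (simp add: presented_quandle_def quotientI)
  have "f (qcong A R `` {QOp s t}) = qop X (f (qcong A R `` {s})) (f (qcong A R `` {t}))"
    using f QOp.prems C by (simp add: quandle_Hom_def flip: qop_presented_quandle)
  then show ?case using QOp by simp
next
  case (QInv s t)
  let ?C = "\<lambda>r. qcong A R `` {r}"
  have C: "?C r \<in> qcarrier (presented_quandle A R)" if "r \<in> qterms A" for r
    using that by (simp add: presented_quandle_def quotientI)
  then have fC: "f (?C r) \<in> qcarrier X" if "r \<in> qterms A" for r
    using f that unfolding quandle_Hom_def by blast
  have st: "s \<in> qterms A" "t \<in> qterms A" using QInv.prems by auto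
  have "?C s = ?C (QOp (QInv s t) t)"
    by (rule equiv_class_eq[OF equiv_qcong, symmetric]) (rule qcong.op_inv[OF st])
  then have "f (?C s) = qop X (f (?C (QInv s t))) (f (?C t))"
    using f QInv.prems C st by (simp add: quandle_Hom_def flip: qop_presented_quandle)
  then have "inv_into (qcarrier X) (\<lambda>x. qop X x (f (?C t))) (f (?C s)) = f (?C (QInv s t))"
    using bij_betw_inv_into_left[OF qop_bij[OF fC[OF st(2)]] fC[OF QInv.prems]] by simp
  then show ?case using QInv.IH st by simp
qed simp

text \<open>The universal property of a presented quandle: the congruence is sound for evaluation, so every
  admissible assignment of the generators extends, and generators determine homomorphisms.\<close>

theorem Hom_presented_quandle_bij:
  assumes R: "R \<subseteq> qterms A \<times> qterms A"
  shows "bij_betw (\<lambda>f. \<lambda>a\<in>A. f (qcong A R `` {QGen a}))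
    (quandle_Hom (presented_quandle A R) X) (generator_assignments A R X)"
proof (rule bij_betw_imageI)
  let ?Q = "presented_quandle A R" and ?C = "\<lambda>t. qcong A R `` {t}"
  have carrier: "qcarrier ?Q = ?C ` qterms A"
    by (auto simp: presented_quandle_def quotient_def)
  show "inj_on (\<lambda>f. \<lambda>a\<in>A. f (?C (QGen a))) (quandle_Hom ?Q X)"
  proof (rule inj_onI)
    fix f f' assume f: "f \<in> quandle_Hom ?Q X" and f': "f' \<in> quandle_Hom ?Q X"
      and eq: "(\<lambda>a\<in>A. f (?C (QGen a))) = (\<lambda>a\<in>A. f' (?C (QGen a)))"
    have "f (?C t) = f' (?C t)" if "t \<in> qterms A" for t
      using Hom_eq_qeval[OF f that] Hom_eq_qeval[OF f' that] eq by simp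
    then show "f = f'"
      using f f' by (intro PiE_ext[of f "qcarrier ?Q" "\<lambda>_. qcarrier X"]) (auto simp: quandle_Hom_def carrier)
  qed
  show "(\<lambda>f. \<lambda>a\<in>A. f (?C (QGen a))) ` quandle_Hom ?Q X = generator_assignments A R X"
  proof (intro equalityI subsetI)
    fix g assume "g \<in> (\<lambda>f. \<lambda>a\<in>A. f (?C (QGen a))) ` quandle_Hom ?Q X"
    then obtain f where f: "f \<in> quandle_Hom ?Q X" and g: "g = (\<lambda>a\<in>A. f (?C (QGen a)))"
      by blast
    have "qeval X g s = qeval X g t" if "(s, t) \<in> R" for s t
    proof -
      have st: "s \<in> qterms A" "t \<in> qterms A" using R that by auto
      then have "?C s = ?C t"
        using that by (intro equiv_class_eq[OF equiv_qcong] qcong.rel)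
      then show ?thesis
        using Hom_eq_qeval[OF f st(1)] Hom_eq_qeval[OF f st(2)] by (simp add: g)
    qed
    moreover have "g \<in> A \<rightarrow>\<^sub>E qcarrier X"
      using f by (auto simp: g quandle_Hom_def carrier)
    ultimately show "g \<in> generator_assignments A R X"
      by (auto simp: generator_assignments_def)
  next
    fix g assume "g \<in> generator_assignments A R X"
    then have g: "g \<in> A \<rightarrow>\<^sub>E qcarrier X" "g \<in> A \<rightarrow> qcarrier X"
      and gR: "\<forall>(s, t)\<in>R. qeval X g s = qeval X g t"
      by (auto simp: generator_assignments_def)
    define f where "f = (\<lambda>c\<in>qcarrier ?Q. qeval X g (SOME t. t \<in> c))"
    have f: "f (?C t) = qeval X g t" if t: "t \<in> qterms A" for t
    proof -
      have "t \<in> ?C t" using t by (simp add: qcong.refl)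
      then have "(SOME s. s \<in> ?C t) \<in> ?C t" by (rule someI)
      then have "(t, SOME s. s \<in> ?C t) \<in> qcong A R" by simp
      from qeval_qcong[OF g(2) gR this] show ?thesis
        using t by (simp add: f_def carrier)
    qed
    have "f \<in> quandle_Hom ?Q X"
      unfolding quandle_Hom_def
    proof (intro CollectI conjI ballI PiE_I)
      fix c assume "c \<in> qcarrier ?Q"
      then show "f c \<in> qcarrier X" using qeval_closed[OF g(2)] by (auto simp: carrier f)
    next
      fix c assume "c \<notin> qcarrier ?Q"
      then show "f c = undefined" by (simp add: f_def)
    next
      fix c d assume "c \<in> qcarrier ?Q" "d \<in> qcarrier ?Q"
      then show "f (qop ?Q c d) = qop X (f c) (f d)"
        by (auto simp: carrier f qop_presented_quandle)
    qed
    moreover have "(\<lambda>a\<in>A. f (?C (QGen a))) = g"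
      using g(1) by (auto simp: f PiE_def extensional_def)
    ultimately show "g \<in> (\<lambda>f. \<lambda>a\<in>A. f (?C (QGen a))) ` quandle_Hom ?Q X"
      by blast
  qed
qed

end


section \<open>Colorings of a link diagram\<close>

definition edge_colorings :: "'e diagram \<Rightarrow> 'b qstruct \<Rightarrow> ('e \<Rightarrow> 'b) set" where
  "edge_colorings D X =
     {f \<in> edges D \<rightarrow>\<^sub>E qcarrier X.
        (\<forall>(e, e')\<in>joins D. f e = f e') \<and>
        (\<forall>c\<in>crossings D. f (over_in c) = f (over_out c) \<and>
           f (under_left c) = qop X (f (under_right c)) (f (over_in c)))}"

definition diagram_wf :: "'e diagram \<Rightarrow> bool" where
  "diagram_wf D \<longleftrightarrow> joins D \<subseteq> edges D \<times> edges D \<and>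
     (\<forall>c\<in>crossings D. {over_in c, over_out c, under_right c, under_left c} \<subseteq> edges D)"

lemma equiv_same_arc: "equiv UNIV (same_arc D)"
proof (rule equivI)
  show "refl_on UNIV (same_arc D)"
    by (simp add: same_arc_def Let_def refl_on_def)
  show "sym_on UNIV (same_arc D)"
    unfolding same_arc_def Let_def by (intro sym_rtrancl sym_Un_converse)
  show "trans_on UNIV (same_arc D)"
    unfolding same_arc_def Let_def by (rule trans_rtrancl)
qed simp

text \<open>To be constant on arcs it suffices to be unchanged by the generating steps, namely the joins and the
  passages over a crossing.\<close>

lemma same_arc_invariant:
  assumes "\<And>e e'. (e, e') \<in> joins D \<Longrightarrow> P e = P e'"
    and "\<And>c. c \<in> crossings D \<Longrightarrow> P (over_in c) = P (over_out c)"
    and "(e, e') \<in> same_arc D"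
  shows "P e = P e'"
  using assms(3) unfolding same_arc_def Let_def
  by (induction rule: rtrancl_induct) (use assms(1,2) in auto)

lemma arc_of_join: "(e, e') \<in> joins D \<Longrightarrow> arc_of D e = arc_of D e'"
  unfolding arc_of_def same_arc_def Let_def
  by (rule equiv_class_eq[OF equiv_same_arc[unfolded same_arc_def Let_def]], rule r_into_rtrancl) simp

lemma arc_of_over: "c \<in> crossings D \<Longrightarrow> arc_of D (over_in c) = arc_of D (over_out c)"
  unfolding arc_of_def same_arc_def Let_def
  by (rule equiv_class_eq[OF equiv_same_arc[unfolded same_arc_def Let_def]], rule r_into_rtrancl) simp

text \<open>An assignment on arcs and an edge coloring constant along arcs carry the same information: pull back
  along \<open>arc_of\<close> in one direction, evaluate at any representative in the other.\<close>

theorem card_Hom_fundamental_quandle: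
  assumes X: "quandle X" and D: "diagram_wf D"
  shows "card (quandle_Hom (fundamental_quandle D) X) = card (edge_colorings D X)"
proof -
  let ?A = "arcs D" and ?R = "crossing_relation D ` crossings D"
  have arc: "arc_of D e \<in> ?A" if "e \<in> edges D" for e
    using that by (simp add: arcs_def)
  have R: "?R \<subseteq> qterms ?A \<times> qterms ?A"
    using D by (auto simp: crossing_relation_def diagram_wf_def intro!: arc)
  have "bij_betw (\<lambda>g. \<lambda>e\<in>edges D. g (arc_of D e)) (generator_assignments ?A ?R X) (edge_colorings D X)"
  proof (rule bij_betw_imageI)
    show "inj_on (\<lambda>g. \<lambda>e\<in>edges D. g (arc_of D e)) (generator_assignments ?A ?R X)"
    proof (rule inj_onI)
      fix g g' assume g: "g \<in> generator_assignments ?A ?R X" "g' \<in> generator_assignments ?A ?R X"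
        and eq: "(\<lambda>e\<in>edges D. g (arc_of D e)) = (\<lambda>e\<in>edges D. g' (arc_of D e))"
      have "g (arc_of D e) = g' (arc_of D e)" if "e \<in> edges D" for e
        using fun_cong[OF eq, of e] that by simp
      then show "g = g'"
        using g by (intro PiE_ext[of g ?A "\<lambda>_. qcarrier X"])
          (auto simp: generator_assignments_def arcs_def)
    qed
    show "(\<lambda>g. \<lambda>e\<in>edges D. g (arc_of D e)) ` generator_assignments ?A ?R X = edge_colorings D X"
    proof (intro equalityI subsetI)
      fix f assume "f \<in> (\<lambda>g. \<lambda>e\<in>edges D. g (arc_of D e)) ` generator_assignments ?A ?R X"
      then obtain g where g: "g \<in> generator_assignments ?A ?R X"
        and f: "f = (\<lambda>e\<in>edges D. g (arc_of D e))" by blast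
      have "f \<in> edges D \<rightarrow>\<^sub>E qcarrier X"
        using g arc by (auto simp: f generator_assignments_def)
      moreover have "f e = f e'" if "(e, e') \<in> joins D" for e e'
        using that D by (auto simp: f diagram_wf_def dest: arc_of_join)
      moreover have "f (over_in c) = f (over_out c)"
        "f (under_left c) = qop X (f (under_right c)) (f (over_in c))" if "c \<in> crossings D" for c
        using that D g by (auto simp: f diagram_wf_def generator_assignments_def
            crossing_relation_def dest: arc_of_over)
      ultimately show "f \<in> edge_colorings D X"
        by (auto simp: edge_colorings_def)
    next
      fix f assume "f \<in> edge_colorings D X"
      then have f: "f \<in> edges D \<rightarrow>\<^sub>E qcarrier X"
        and join: "\<And>e e'. (e, e') \<in> joins D \<Longrightarrow> f e = f e'"
        and over: "\<And>c. c \<in> crossings D \<Longrightarrow> f (over_in c) = f (over_out c)"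
        and under: "\<And>c. c \<in> crossings D \<Longrightarrow>
          f (under_left c) = qop X (f (under_right c)) (f (over_in c))"
        by (auto simp: edge_colorings_def)
      define g where "g = (\<lambda>a\<in>?A. f (SOME e. e \<in> a))"
      have g: "g (arc_of D e) = f e" if "e \<in> edges D" for e
      proof -
        have "e \<in> arc_of D e"
          unfolding arc_of_def using equiv_class_self[OF equiv_same_arc] by simp
        then have "(SOME e'. e' \<in> arc_of D e) \<in> arc_of D e" by (rule someI)
        then have "(e, SOME e'. e' \<in> arc_of D e) \<in> same_arc D" by (simp add: arc_of_def)
        from same_arc_invariant[of D f, OF join over this] show ?thesis
          using arc[OF that] by (simp add: g_def)
      qed
      have "g \<in> ?A \<rightarrow>\<^sub>E qcarrier X"
      proof (rule PiE_I)
        fix a assume "a \<in> ?A"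
        then show "g a \<in> qcarrier X" using f by (auto simp: arcs_def g)
      qed (simp add: g_def)
      moreover have "qeval X g s = qeval X g t" if "(s, t) \<in> ?R" for s t
      proof -
        obtain c where c: "c \<in> crossings D" and st: "(s, t) = crossing_relation D c"
          using \<open>(s, t) \<in> ?R\<close> by blast
        then have "under_left c \<in> edges D" "under_right c \<in> edges D" "over_in c \<in> edges D"
          using D by (auto simp: diagram_wf_def)
        then show ?thesis
          using st under[OF c] by (simp add: crossing_relation_def g)
      qed
      ultimately have "g \<in> generator_assignments ?A ?R X"
        unfolding generator_assignments_def by blast
      moreover have "(\<lambda>e\<in>edges D. g (arc_of D e)) = f"
        using f by (auto simp: g PiE_def extensional_def)
      ultimately show "f \<in> (\<lambda>g. \<lambda>e\<in>edges D. g (arc_of D e)) ` generator_assignments ?A ?R X"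
        by blast
    qed
  qed
  then show ?thesis
    using bij_betw_same_card[OF Hom_presented_quandle_bij[OF X R]]
    by (simp add: bij_betw_same_card fundamental_quandle_def)
qed


section \<open>Dihedral colorings of pretzel links\<close>

text \<open>The sign with which a crossing adds the difference of the colors to both of them. It depends only on
  which of the two strands is over.\<close>

definition twist_sign :: "bool \<Rightarrow> int \<Rightarrow> int" where
  "twist_sign h p = (if (p > 0) = h then 1 else - 1)"

lemma reflection_swap:
  fixes x y z n :: int
  assumes "x \<in> {0..<n}" "z \<in> {0..<n}"
  shows "x = (2 * y - z) mod n \<longleftrightarrow> z = (2 * y - x) mod n"
proof -
  have "(2 * y - (2 * y - w) mod n) mod n = w" if "w \<in> {0..<n}" for w
    using that by (simp add: mod_diff_right_eq)
  then show ?thesis using assms by metis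
qed

text \<open>If the NE--SW strand is over, the colors \<open>(x, y)\<close> above a crossing become \<open>(y, 2 y - x)\<close> below it; if
  the NW--SE strand is over, they become \<open>(2 x - y, x)\<close>. In both cases \<open>\<plusminus> (y - x)\<close> has been added to
  each. Reversing the over strand exchanges the two under edges in the relation, which is harmless
  because right translations of a dihedral quandle are involutions.\<close>

lemma pretzel_crossing_dihedral:
  fixes f :: "pedge \<Rightarrow> int" and h ps down i k
  assumes f: "\<And>l s. l \<in> {k, Suc k} \<Longrightarrow> f (i, l, s) \<in> {0..<n}"
  defines "c \<equiv> pretzel_crossing h ps down i k"
  shows "f (over_in c) = f (over_out c) \<and> f (under_left c) = (2 * f (over_in c) - f (under_right c)) mod n
    \<longleftrightarrow> (\<forall>s. f (i, Suc k, s) = (f (i, k, s) + twist_sign h (ps ! i) * (f (i, k, Rgt) - f (i, k, Lft))) mod n)"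
proof -
  have all: "(\<forall>s. P s) \<longleftrightarrow> P Lft \<and> P Rgt" for P
    by (metis side.exhaust)
  have m: "f (i, l, s) mod n = f (i, l, s)" if "l \<in> {k, Suc k}" for l s
    using f[OF that] by simp
  have r: "f (i, l, s) = (2 * y - f (i, l', s')) mod n \<longleftrightarrow> f (i, l', s') = (2 * y - f (i, l, s)) mod n"
    if "l \<in> {k, Suc k}" "l' \<in> {k, Suc k}" for l s l' s' y
    using reflection_swap[OF f f] that by blast
  show ?thesis
  proof (cases "(ps ! i > 0) = h")
    case True
    then show ?thesis
      using m[of k Rgt] r[of k "Suc k" Lft "f (i, k, Rgt)" Rgt]
      by (auto simp: c_def pretzel_crossing_def Let_def twist_sign_def all algebra_simps)
  next
    case False
    then show ?thesis
      using m[of k Lft] r[of k "Suc k" Rgt "f (i, k, Lft)" Lft]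
      by (auto simp: c_def pretzel_crossing_def Let_def twist_sign_def all algebra_simps)
  qed
qed

lemma diagram_wf_pretzel: "diagram_wf (pretzel_diagram h ps down)"
proof -
  have "joins (pretzel_diagram h ps down) \<subseteq> pretzel_edges ps \<times> pretzel_edges ps"
    by (auto simp: pretzel_diagram_def pretzel_joins_def pretzel_edges_def Let_def intro!: mod_less_divisor)
  moreover have "{over_in c, over_out c, under_right c, under_left c} \<subseteq> pretzel_edges ps"
    if "c \<in> crossings (pretzel_diagram h ps down)" for c
    using that by (auto simp: pretzel_diagram_def pretzel_crossing_def pretzel_edges_def Let_def
        split: if_splits)
  ultimately show ?thesis
    by (simp add: diagram_wf_def pretzel_diagram_def)
qed

lemma pretzel_colorings_iff:
  "f \<in> edge_colorings (pretzel_diagram h ps down) (dihedral_quandle n) \<longleftrightarrow>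
    f \<in> pretzel_edges ps \<rightarrow>\<^sub>E {0..<n} \<and>
    (\<forall>i<length ps. \<forall>j. j = Suc i mod length ps \<longrightarrow>
        f (i, 0, Rgt) = f (j, 0, Lft) \<and> f (i, ncross ps i, Rgt) = f (j, ncross ps j, Lft)) \<and>
    (\<forall>i<length ps. \<forall>k<ncross ps i. \<forall>s. f (i, Suc k, s) =
        (f (i, k, s) + twist_sign h (ps ! i) * (f (i, k, Rgt) - f (i, k, Lft))) mod n)"
  (is "_ \<longleftrightarrow> _ \<and> ?J \<and> (\<forall>i<_. \<forall>k<_. ?C i k)")
proof (cases "f \<in> pretzel_edges ps \<rightarrow>\<^sub>E {0..<n}")
  case True
  let ?D = "pretzel_diagram h ps down"
  have joins: "(\<forall>(e, e')\<in>joins ?D. f e = f e') \<longleftrightarrow> ?J"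
    by (auto simp: pretzel_diagram_def pretzel_joins_def Let_def)
  have "f (i, l, s) \<in> {0..<n}" if "i < length ps" "l \<le> ncross ps i" for i l s
    using True that by (auto simp: pretzel_edges_def)
  then have cross: "f (over_in (pretzel_crossing h ps down i k)) = f (over_out (pretzel_crossing h ps down i k)) \<and>
      f (under_left (pretzel_crossing h ps down i k)) =
        (2 * f (over_in (pretzel_crossing h ps down i k))
          - f (under_right (pretzel_crossing h ps down i k))) mod n \<longleftrightarrow> ?C i k"
    if "i < length ps" "k < ncross ps i" for i k
    using that by (intro pretzel_crossing_dihedral) auto
  have "(\<forall>c\<in>crossings ?D. f (over_in c) = f (over_out c) \<and>
           f (under_left c) = (2 * f (over_in c) - f (under_right c)) mod n) \<longleftrightarrow>
      (\<forall>i<length ps. \<forall>k<ncross ps i.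
        f (over_in (pretzel_crossing h ps down i k)) = f (over_out (pretzel_crossing h ps down i k)) \<and>
        f (under_left (pretzel_crossing h ps down i k)) =
          (2 * f (over_in (pretzel_crossing h ps down i k))
            - f (under_right (pretzel_crossing h ps down i k))) mod n)"
    by (auto simp: pretzel_diagram_def)
  also have "\<dots> \<longleftrightarrow> (\<forall>i<length ps. \<forall>k<ncross ps i. ?C i k)"
    using cross by auto
  finally show ?thesis
    using True joins by (simp add: edge_colorings_def dihedral_quandle_def pretzel_diagram_def)
next
  case False
  then show ?thesis
    by (auto simp: edge_colorings_def dihedral_quandle_def pretzel_diagram_def)
qed

text \<open>Candidate colors for the upper left corners of the columns, with the condition that the lower joins
  impose on them.\<close>

definition cap_colorings :: "int list \<Rightarrow> int \<Rightarrow> (nat \<Rightarrow> int) set" where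
  "cap_colorings ps n =
     {a \<in> {..<length ps} \<rightarrow>\<^sub>E {0..<n}.
        \<forall>i<length ps. \<forall>j. j = Suc i mod length ps \<longrightarrow>
          [ps ! i * (a j - a i) = ps ! j * (a (Suc j mod length ps) - a j)] (mod n)}"

text \<open>The integer coloring that propagates the corner colors down the columns; reduced modulo \<open>n\<close> it is the
  only possible coloring of the edges.\<close>

definition column_coloring :: "bool \<Rightarrow> int list \<Rightarrow> (nat \<Rightarrow> int) \<Rightarrow> pedge \<Rightarrow> int" where
  "column_coloring h ps a = (\<lambda>(i, k, s).
     (case s of Lft \<Rightarrow> a i | Rgt \<Rightarrow> a (Suc i mod length ps))
       + int k * twist_sign h (ps ! i) * (a (Suc i mod length ps) - a i))"

text \<open>After all crossings of a column, the sign of the twist and the number of crossings combine to the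
  signed twist number, up to a global sign that depends on the handedness only and therefore cancels
  when the bottoms of two columns are compared.\<close>

lemma column_coloring_bottom:
  fixes h ps a
  defines "w \<equiv> (\<lambda>i. (if h then 1 else - 1) * (ps ! i * (a (Suc i mod length ps) - a i)))"
  shows "column_coloring h ps a (i, ncross ps i, Lft) = a i + w i"
    and "column_coloring h ps a (i, ncross ps i, Rgt) = a (Suc i mod length ps) + w i"
  by (auto simp: column_coloring_def ncross_def twist_sign_def w_def)

lemma column_coloring_cong:
  assumes f: "\<And>k s. k < l \<Longrightarrow> f (i, Suc k, s) =
      (f (i, k, s) + twist_sign h (ps ! i) * (f (i, k, Rgt) - f (i, k, Lft))) mod n"
    and "[f (i, 0, Lft) = a i] (mod n)" "[f (i, 0, Rgt) = a (Suc i mod length ps)] (mod n)"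
  shows "k \<le> l \<Longrightarrow> [f (i, k, s) = column_coloring h ps a (i, k, s)] (mod n)"
proof (induction k arbitrary: s)
  case 0
  then show ?case using assms(2,3) by (cases s) (simp_all add: column_coloring_def)
next
  case (Suc k)
  let ?F = "column_coloring h ps a" and ?e = "twist_sign h (ps ! i)"
  have "[f (i, Suc k, s) = f (i, k, s) + ?e * (f (i, k, Rgt) - f (i, k, Lft))] (mod n)"
    using Suc.prems f[of k s] by (simp add: cong_def)
  also have "[f (i, k, s) + ?e * (f (i, k, Rgt) - f (i, k, Lft))
      = ?F (i, k, s) + ?e * (?F (i, k, Rgt) - ?F (i, k, Lft))] (mod n)"
    using Suc by (intro cong_add cong_mult cong_diff cong_refl) auto
  also have "?F (i, k, s) + ?e * (?F (i, k, Rgt) - ?F (i, k, Lft)) = ?F (i, Suc k, s)"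
    by (cases s) (simp_all add: column_coloring_def algebra_simps)
  finally show ?case .
qed

text \<open>A coloring is determined by its values at the upper left corners, and corner values extend downwards
  exactly when the extension is compatible with the lower joins.\<close>

theorem card_pretzel_colorings:
  assumes n: "n > 0"
  shows "card (edge_colorings (pretzel_diagram h ps down) (dihedral_quandle n))
       = card (cap_colorings ps n)"
proof -
  let ?m = "length ps" and ?E = "pretzel_edges ps" and ?F = "column_coloring h ps"
  let ?col = "edge_colorings (pretzel_diagram h ps down) (dihedral_quandle n)"
  define top where "top f = (\<lambda>i\<in>{..<?m}. f (i, 0, Lft))" for f :: "pedge \<Rightarrow> int"
  define fill where "fill a = (\<lambda>e\<in>?E. ?F a e mod n)" for a
  have succ: "Suc i mod ?m < ?m" if "i < ?m" for i
    using that by (intro mod_less_divisor) auto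
  have edge: "(i, k, s) \<in> ?E \<longleftrightarrow> i < ?m \<and> k \<le> ncross ps i" for i k s
    by (simp add: pretzel_edges_def)
  have cap_iff: "[b + (if h then 1 else - 1) * x = b + (if h then 1 else - 1) * y] (mod n)
      \<longleftrightarrow> [x = y] (mod n)" for b x y :: int
    by (simp add: cong_add_lcancel cong_minus_minus_iff)
  have bottom: "[?F a (i, ncross ps i, Rgt) = ?F a (j, ncross ps j, Lft)] (mod n) \<longleftrightarrow>
      [ps ! i * (a j - a i) = ps ! j * (a (Suc j mod ?m) - a j)] (mod n)"
    if "j = Suc i mod ?m" for a i j
    using that by (simp only: column_coloring_bottom cap_iff)
  have filled: "[f (i, k, s) = ?F (top f) (i, k, s)] (mod n)"
    if "f \<in> ?col" "i < ?m" "k \<le> ncross ps i" for f i k s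
  proof (rule column_coloring_cong[where l = "ncross ps i"])
    show "[f (i, 0, Lft) = top f i] (mod n)" "[f (i, 0, Rgt) = top f (Suc i mod ?m)] (mod n)"
      using that succ[of i] by (simp_all add: pretzel_colorings_iff top_def)
  qed (use that in \<open>auto simp: pretzel_colorings_iff\<close>)
  have "bij_betw top ?col (cap_colorings ps n)"
  proof (rule bij_betw_byWitness[where f' = fill])
    show "\<forall>f\<in>?col. fill (top f) = f"
    proof (intro ballI ext)
      fix f and e :: pedge assume f: "f \<in> ?col"
      then have fE: "f \<in> ?E \<rightarrow>\<^sub>E {0..<n}" by (simp add: pretzel_colorings_iff)
      obtain i k s where e: "e = (i, k, s)" by (cases e)
      show "fill (top f) e = f e"
      proof (cases "e \<in> ?E")
        case True
        then have "f e mod n = f e" using PiE_mem[OF fE] by simp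
        then show ?thesis
          using filled[OF f, of i k s] True e by (simp add: fill_def edge cong_def)
      next
        case False
        then show ?thesis using PiE_arb[OF fE False] by (simp add: fill_def)
      qed
    qed
    show "\<forall>a\<in>cap_colorings ps n. top (fill a) = a"
    proof (intro ballI ext)
      fix a i assume a: "a \<in> cap_colorings ps n"
      show "top (fill a) i = a i"
      proof (cases "i < ?m")
        case True
        then have "a i \<in> {0..<n}" using a by (auto simp: cap_colorings_def)
        then show ?thesis using True by (simp add: top_def fill_def edge column_coloring_def)
      next
        case False
        then show ?thesis using a by (auto simp: top_def cap_colorings_def)
      qed
    qed
    show "top ` ?col \<subseteq> cap_colorings ps n"
    proof clarify
      fix f assume f: "f \<in> ?col"
      have "[?F (top f) (i, ncross ps i, Rgt) = ?F (top f) (j, ncross ps j, Lft)] (mod n)"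
        if i: "i < ?m" and j: "j = Suc i mod ?m" for i j
      proof -
        have "f (i, ncross ps i, Rgt) = f (j, ncross ps j, Lft)"
          using f i j by (simp add: pretzel_colorings_iff)
        moreover have "[f (i, ncross ps i, Rgt) = ?F (top f) (i, ncross ps i, Rgt)] (mod n)"
          "[f (j, ncross ps j, Lft) = ?F (top f) (j, ncross ps j, Lft)] (mod n)"
          using filled[OF f] i succ[OF i] j by blast+
        ultimately show ?thesis by (simp add: cong_def)
      qed
      moreover have "top f \<in> {..<?m} \<rightarrow>\<^sub>E {0..<n}"
        using f by (auto simp: pretzel_colorings_iff top_def edge)
      ultimately show "top f \<in> cap_colorings ps n"
        by (simp add: cap_colorings_def bottom)
    qed
    show "fill ` cap_colorings ps n \<subseteq> ?col"
    proof clarify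
      fix a assume a: "a \<in> cap_colorings ps n"
      have "fill a \<in> ?E \<rightarrow>\<^sub>E {0..<n}"
        using n by (auto simp: fill_def)
      moreover have "fill a (i, 0, Rgt) = fill a (j, 0, Lft)"
        "fill a (i, ncross ps i, Rgt) = fill a (j, ncross ps j, Lft)"
        if i: "i < ?m" and j: "j = Suc i mod ?m" for i j
      proof -
        show "fill a (i, 0, Rgt) = fill a (j, 0, Lft)"
          using i j succ[OF i] by (simp add: fill_def edge column_coloring_def)
        have "[?F a (i, ncross ps i, Rgt) = ?F a (j, ncross ps j, Lft)] (mod n)"
          using a i j by (simp add: bottom cap_colorings_def)
        then show "fill a (i, ncross ps i, Rgt) = fill a (j, ncross ps j, Lft)"
          using i j succ[OF i] by (simp add: fill_def edge cong_def)
      qed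
      moreover have "fill a (i, Suc k, s) =
          (fill a (i, k, s) + twist_sign h (ps ! i) * (fill a (i, k, Rgt) - fill a (i, k, Lft))) mod n"
        if "i < ?m" "k < ncross ps i" for i k s
      proof -
        have "?F a (i, Suc k, s) =
            ?F a (i, k, s) + twist_sign h (ps ! i) * (?F a (i, k, Rgt) - ?F a (i, k, Lft))"
          by (cases s) (simp_all add: column_coloring_def algebra_simps)
        moreover have "[?F a (i, k, s) + twist_sign h (ps ! i) * (?F a (i, k, Rgt) - ?F a (i, k, Lft))
            = fill a (i, k, s) + twist_sign h (ps ! i) * (fill a (i, k, Rgt) - fill a (i, k, Lft))] (mod n)"
          using that by (intro cong_add cong_mult cong_diff cong_refl) (simp_all add: fill_def edge)
        ultimately show ?thesis using that by (simp add: fill_def edge cong_def)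
      qed
      ultimately show "fill a \<in> ?col"
        by (simp add: pretzel_colorings_iff)
    qed
  qed
  then show ?thesis by (rule bij_betw_same_card)
qed


section \<open>Counting solutions of linear congruences\<close>

lemma dvd_mult_gcd_iff:
  fixes k x a b :: int
  shows "k dvd x * gcd a b \<longleftrightarrow> k dvd x * a \<and> k dvd x * b"
proof -
  have "k dvd x * gcd a b \<longleftrightarrow> k dvd \<bar>x\<bar> * gcd a b"
    by (simp add: abs_if)
  also have "\<dots> \<longleftrightarrow> k dvd x * a \<and> k dvd x * b"
    by (simp add: gcd_mult_distrib_int)
  finally show ?thesis .
qed

text \<open>Identities between nested greatest common divisors reduce with this to propositional logic about
  common divisors.\<close>

lemma eq_if_same_divisors:
  fixes a b :: int
  assumes "\<And>k. k dvd a \<longleftrightarrow> k dvd b" "a \<ge> 0" "b \<ge> 0"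
  shows "a = b"
  using assms(1)[of a] assms(1)[of b] assms(2,3) by (simp add: zdvd_antisym_nonneg)

lemma card_multiples_mod:
  fixes u n :: int
  assumes "n > 0"
  shows "int (card {x \<in> {0..<n}. n dvd u * x}) = gcd u n"
proof -
  define g where "g = gcd u n"
  have "g > 0" using assms by (simp add: g_def)
  obtain u' n' where u': "u = u' * g" "n = n' * g" "coprime u' n'"
    using gcd_coprime_exists[of u n] \<open>g > 0\<close> unfolding g_def by auto
  have "n' > 0" using u' assms \<open>g > 0\<close> by (simp add: zero_less_mult_iff)
  have dvd_iff: "n dvd u * x \<longleftrightarrow> n' dvd x" for x
  proof -
    have "n dvd u * x \<longleftrightarrow> n' * g dvd (u' * x) * g" using u' by (simp add: ac_simps)
    also have "\<dots> \<longleftrightarrow> n' dvd x"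
      using \<open>g > 0\<close> u'(3) by (simp add: coprime_commute coprime_dvd_mult_right_iff)
    finally show ?thesis .
  qed
  have "{x \<in> {0..<n}. n dvd u * x} = (\<lambda>k. n' * k) ` {0..<g}"
    unfolding dvd_iff using \<open>n' > 0\<close> u'(2)
    by (auto simp: image_iff zero_le_mult_iff elim!: dvdE)
  then show ?thesis
    using \<open>n' > 0\<close> \<open>g > 0\<close> by (simp add: card_image inj_on_def g_def)
qed

text \<open>A solvable inhomogeneous congruence has as many solutions as the homogeneous one, by translation by
  a particular solution, which Bezout's identity provides.\<close>

lemma card_linear_congruence:
  fixes u w n :: int
  assumes "n > 0"
  shows "int (card {y \<in> {0..<n}. n dvd w + u * y}) = (if gcd u n dvd w then gcd u n else 0)"
proof (cases "gcd u n dvd w")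
  case True
  obtain r s where "r * u + s * n = gcd u n" using bezout_int by blast
  moreover obtain k where "w = gcd u n * k" using True by blast
  ultimately have w: "w = k * r * u + k * s * n" by (simp add: algebra_simps flip: distrib_left)
  define z where "z = k * r"
  \<comment> \<open>\<open>- z\<close> is a particular solution\<close>
  have key: "n dvd w + u * y \<longleftrightarrow> n dvd u * (y + z)" for y
  proof -
    have "w + u * y = u * (y + z) + n * (k * s)" by (simp add: w z_def algebra_simps)
    then show ?thesis by (simp add: dvd_add_left_iff)
  qed
  have m: "n dvd u * (x mod n) \<longleftrightarrow> n dvd u * x" for x
    by (metis dvd_eq_mod_eq_0 mod_mult_right_eq)
  have "bij_betw (\<lambda>y. (y + z) mod n) {y \<in> {0..<n}. n dvd w + u * y} {x \<in> {0..<n}. n dvd u * x}"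
  proof (rule bij_betw_byWitness[where f' = "\<lambda>x. (x - z) mod n"])
    have "n dvd u * ((x - z) mod n + z)" if "n dvd u * x" for x
      using that by (metis diff_add_cancel m mod_add_left_eq)
    then show "(\<lambda>x. (x - z) mod n) ` {x \<in> {0..<n}. n dvd u * x} \<subseteq> {y \<in> {0..<n}. n dvd w + u * y}"
      using assms by (auto simp: key)
  qed (use assms in \<open>auto simp: key m mod_diff_left_eq mod_add_left_eq\<close>)
  from bij_betw_same_card[OF this] show ?thesis
    using True card_multiples_mod[OF assms, of u] by simp
next
  case False
  have "\<not> n dvd w + u * y" for y
  proof
    assume "n dvd w + u * y"
    then have "gcd u n dvd w + u * y" by (meson dvd_trans gcd_dvd2)
    then show False using False by (simp add: dvd_add_left_iff)
  qed
  then show ?thesis using False by simp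
qed

text \<open>Write \<open>e = gcd v n\<close>. The second congruence can be solved for \<open>y\<close> exactly when \<open>e\<close> divides \<open>u x\<close>,
  and then has \<open>e\<close> solutions. Multiplied by \<open>n / e\<close>, the solvability condition becomes a congruence
  modulo \<open>n\<close>, which merges with the first congruence into the single condition
  \<open>n dvd gcd g ((n / e) u) * x\<close>. This leaves \<open>e * gcd (gcd g ((n / e) u)) n\<close> solutions.\<close>

lemma card_triangular_system:
  fixes g u v n :: int
  assumes n: "n > 0"
  shows "int (card {(x, y). x \<in> {0..<n} \<and> y \<in> {0..<n} \<and> n dvd g * x \<and> n dvd u * x + v * y})
       = gcd (g * v) (gcd (n * gcd g (gcd u v)) (n * n))"
proof -
  define e where "e = gcd v n"
  have "e > 0" using n by (simp add: e_def)
  obtain n' where n': "n = e * n'" unfolding e_def by (meson dvdE gcd_dvd2)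
  let ?X = "{x \<in> {0..<n}. n dvd g * x}"
  let ?w = "gcd g (n' * u)"
  have e_iff: "e dvd u * x \<longleftrightarrow> n dvd n' * u * x" for x
  proof -
    have "n' \<noteq> 0" using n n' by auto
    then have "e dvd u * x \<longleftrightarrow> n' * e dvd n' * (u * x)"
      by (simp only: dvd_mult_cancel_left) simp
    also have "n' * e = n" using n' by (simp only: mult.commute)
    finally show ?thesis by (simp only: mult.assoc)
  qed
  have fin: "finite ?X" by (rule finite_subset[of _ "{0..<n}"]) auto
  have "{(x, y). x \<in> {0..<n} \<and> y \<in> {0..<n} \<and> n dvd g * x \<and> n dvd u * x + v * y}
      = (SIGMA x:?X. {y \<in> {0..<n}. n dvd u * x + v * y})"
    by auto
  then have "int (card {(x, y). x \<in> {0..<n} \<and> y \<in> {0..<n} \<and> n dvd g * x \<and> n dvd u * x + v * y})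
      = (\<Sum>x\<in>?X. int (card {y \<in> {0..<n}. n dvd u * x + v * y}))"
    by (simp only: card_SigmaI[OF fin] of_nat_sum finite_Collect_conjI finite_atLeastLessThan_int
        simp_thms Collect_mem_eq ball_simps)
  also have "\<dots> = (\<Sum>x\<in>?X. if e dvd u * x then e else 0)"
    using card_linear_congruence[OF n, where u = v] by (simp only: e_def)
  also have "\<dots> = e * int (card {x \<in> ?X. e dvd u * x})"
    by (simp only: sum.If_cases[OF fin] sum_constant sum.neutral_const Int_def mem_Collect_eq) simp
  also have "{x \<in> ?X. e dvd u * x} = {x \<in> {0..<n}. n dvd ?w * x}"
  proof -
    have "n dvd ?w * x \<longleftrightarrow> n dvd g * x \<and> n dvd n' * u * x" for x
      using dvd_mult_gcd_iff[of n x g "n' * u"] by (simp add: ac_simps)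
    then show ?thesis by (auto simp: e_iff)
  qed
  also have "int (card \<dots>) = gcd ?w n" by (rule card_multiples_mod[OF n])
  also have "e * gcd ?w n = gcd (g * v) (gcd (n * gcd g (gcd u v)) (n * n))"
  proof (rule eq_if_same_divisors)
    have split: "k dvd e * x \<longleftrightarrow> k dvd v * x \<and> k dvd n * x" for k x
      using dvd_mult_gcd_iff[of k x v n] by (simp add: e_def ac_simps)
    show "k dvd e * gcd ?w n \<longleftrightarrow> k dvd gcd (g * v) (gcd (n * gcd g (gcd u v)) (n * n))" for k
    proof -
      have "k dvd e * gcd ?w n \<longleftrightarrow> k dvd e * g \<and> k dvd n * u \<and> k dvd e * n"
        by (simp add: dvd_mult_gcd_iff n' mult.assoc)
      also have "\<dots> \<longleftrightarrow> k dvd gcd (g * v) (gcd (n * gcd g (gcd u v)) (n * n))"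
        unfolding split by (simp add: dvd_mult_gcd_iff mult.commute)
      finally show ?thesis .
    qed
  qed (use \<open>e > 0\<close> in auto)
  finally show ?thesis .
qed

text \<open>Coprime cofactors with a Bezout relation also exist for \<open>a = b = 0\<close>, where they are not quotients
  by the greatest common divisor.\<close>

lemma bezout_factorization:
  fixes a b :: int
  obtains a' b' s t where "a = gcd a b * a'" "b = gcd a b * b'" "s * a' + t * b' = 1"
proof (cases "gcd a b = 0")
  case True
  then show ?thesis using that[of 1 0 1 0] by simp
next
  case False
  then obtain a' b' where ab: "a = a' * gcd a b" "b = b' * gcd a b" "coprime a' b'"
    using gcd_coprime_exists by blast
  moreover obtain s t where "s * a' + t * b' = 1"
    using bezout_int[of a' b'] ab(3) by auto
  ultimately show ?thesis using that[of a' b' s t] by (simp add: mult.commute)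
qed

text \<open>A substitution of determinant \<open>1\<close> permutes the pairs modulo \<open>n\<close> and changes neither the
  determinant nor the greatest common divisor of the coefficients. The substitution taken here turns
  the first row \<open>(a, b)\<close> into \<open>(gcd a b, 0)\<close>, which makes the system triangular.\<close>

lemma card_homogeneous_system:
  fixes a b c d n :: int
  assumes n: "n > 0"
  shows "int (card {(x, y). x \<in> {0..<n} \<and> y \<in> {0..<n} \<and> n dvd a * x + b * y \<and> n dvd c * x + d * y})
       = gcd (a * d - b * c) (gcd (n * gcd (gcd a b) (gcd c d)) (n * n))"
proof -
  define g where "g = gcd a b"
  obtain a' b' s t where ab: "a = g * a'" "b = g * b'" and st: "s * a' + t * b' = 1"
    unfolding g_def by (rule bezout_factorization)
  define u v where "u = c * s + d * t" and "v = d * a' - c * b'"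
  let ?S = "{(x, y). x \<in> {0..<n} \<and> y \<in> {0..<n} \<and> n dvd a * x + b * y \<and> n dvd c * x + d * y}"
  let ?T = "{(x, y). x \<in> {0..<n} \<and> y \<in> {0..<n} \<and> n dvd g * x \<and> n dvd u * x + v * y}"
  have mod_lin: "(p * (x mod n) + q * (y mod n)) mod n = (p * x + q * y) mod n" for p q x y
    by (metis mod_add_eq mod_mult_right_eq)
  have dvd_mod: "n dvd p * (x mod n) + q * (y mod n) \<longleftrightarrow> n dvd p * x + q * y" for p q x y
    using mod_lin[of p x q y] by (simp only: dvd_eq_mod_eq_0)
  have dvd_mod1: "n dvd p * (x mod n) \<longleftrightarrow> n dvd p * x" for p x
    using dvd_mod[of p x 0 0] by simp
  let ?f = "\<lambda>(x, y). ((s * x + - b' * y) mod n, (t * x + a' * y) mod n)"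
  let ?f' = "\<lambda>(x, y). ((a' * x + b' * y) mod n, (- t * x + s * y) mod n)"
  have "bij_betw ?f ?T ?S"
  proof (rule bij_betw_byWitness[where f' = ?f'])
    show "\<forall>z\<in>?T. ?f' (?f z) = z"
    proof
      fix z assume "z \<in> ?T"
      then obtain x y where z: "z = (x, y)" and xy: "x \<in> {0..<n}" "y \<in> {0..<n}" by blast
      have "a' * (s * x + - b' * y) + b' * (t * x + a' * y) = (s * a' + t * b') * x"
        and "- t * (s * x + - b' * y) + s * (t * x + a' * y) = (s * a' + t * b') * y"
        by (simp_all add: algebra_simps)
      then show "?f' (?f z) = z"
        using xy by (simp only: z split_conv mod_lin st) simp
    qed
    show "\<forall>z\<in>?S. ?f (?f' z) = z"
    proof
      fix z assume "z \<in> ?S"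
      then obtain x y where z: "z = (x, y)" and xy: "x \<in> {0..<n}" "y \<in> {0..<n}" by blast
      have "s * (a' * x + b' * y) + - b' * (- t * x + s * y) = (s * a' + t * b') * x"
        and "t * (a' * x + b' * y) + a' * (- t * x + s * y) = (s * a' + t * b') * y"
        by (simp_all add: algebra_simps)
      then show "?f (?f' z) = z"
        using xy by (simp only: z split_conv mod_lin st) simp
    qed
    show "?f ` ?T \<subseteq> ?S"
    proof (rule image_subsetI)
      fix z assume "z \<in> ?T"
      then obtain x y where z: "z = (x, y)" and xy: "n dvd g * x" "n dvd u * x + v * y" by blast
      have "a * (s * x + - b' * y) + b * (t * x + a' * y) = (s * a' + t * b') * (g * x)"
        by (simp add: ab algebra_simps)
      moreover have "c * (s * x + - b' * y) + d * (t * x + a' * y) = u * x + v * y"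
        by (simp add: u_def v_def algebra_simps)
      ultimately show "?f z \<in> ?S"
        using xy n by (simp add: z dvd_mod st)
    qed
    show "?f' ` ?S \<subseteq> ?T"
    proof (rule image_subsetI)
      fix z assume "z \<in> ?S"
      then obtain x y where z: "z = (x, y)" and xy: "n dvd a * x + b * y" "n dvd c * x + d * y" by blast
      have "g * (a' * x + b' * y) = a * x + b * y"
        by (simp add: ab algebra_simps)
      moreover have "u * (a' * x + b' * y) + v * (- t * x + s * y) = (s * a' + t * b') * (c * x + d * y)"
        by (simp add: u_def v_def algebra_simps)
      ultimately show "?f' z \<in> ?T"
        using xy n by (simp add: z dvd_mod dvd_mod1 st)
    qed
  qed
  then have "int (card ?S) = int (card ?T)"
    by (simp add: bij_betw_same_card)
  also have "\<dots> = gcd (g * v) (gcd (n * gcd g (gcd u v)) (n * n))"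
    by (rule card_triangular_system[OF n])
  also have "g * v = a * d - b * c"
    by (simp add: ab v_def algebra_simps)
  also have "gcd u v = gcd c d"
  proof (rule zdvd_antisym_nonneg)
    have "u * a' - v * t = (s * a' + t * b') * c" "u * b' + v * s = (s * a' + t * b') * d"
      by (simp_all add: u_def v_def algebra_simps)
    then have "c = u * a' - v * t" "d = u * b' + v * s"
      by (simp_all add: st)
    then show "gcd u v dvd gcd c d"
      by (metis dvd_add dvd_diff dvd_mult2 gcd_dvd1 gcd_dvd2 gcd_greatest)
    show "gcd c d dvd gcd u v"
      by (simp add: u_def v_def)
  qed auto
  finally show ?thesis by (simp add: g_def)
qed

text \<open>Expanding the product gives the greatest common divisor of \<open>q r\<close>, \<open>n q\<close>, \<open>n r\<close> and \<open>n\<^sup>2\<close>, and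
  \<open>n r\<close> is a multiple of \<open>n q\<close>.\<close>

lemma gcd_invariant_factors:
  fixes q r n :: int
  assumes "q dvd r"
  shows "gcd q n * gcd r n = gcd (q * r) (gcd (n * q) (n * n))"
proof (rule eq_if_same_divisors)
  show "k dvd gcd q n * gcd r n \<longleftrightarrow> k dvd gcd (q * r) (gcd (n * q) (n * n))" for k
  proof -
    have "k dvd gcd q n * gcd r n \<longleftrightarrow> k dvd q * r \<and> k dvd n * q \<and> k dvd n * r \<and> k dvd n * n"
      using dvd_mult_gcd_iff[of k r q n] dvd_mult_gcd_iff[of k n q n]
        dvd_mult_gcd_iff[of k "gcd q n" r n] by (auto simp: ac_simps)
    moreover have "k dvd n * r" if "k dvd n * q"
      using that assms by (meson dvd_trans mult_dvd_mono dvd_refl)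
    ultimately show ?thesis by auto
  qed
qed auto


section \<open>Pretzel links with three columns\<close>

text \<open>The first color is arbitrary; the two differences that follow it are subject to a linear system. Of
  the three cyclic conditions, the last follows from the other two.\<close>

lemma card_cap_colorings_3:
  fixes p q r n :: int
  assumes n: "n > 0"
  shows "card (cap_colorings [p, q, r] n) =
    nat n * card {(x, y). x \<in> {0..<n} \<and> y \<in> {0..<n} \<and>
      n dvd p * x + (- q) * y \<and> n dvd r * x + (q + r) * y}"
proof -
  let ?K = "{(x, y). x \<in> {0..<n} \<and> y \<in> {0..<n} \<and>
      n dvd p * x + (- q) * y \<and> n dvd r * x + (q + r) * y}"
  let ?f = "\<lambda>a :: nat \<Rightarrow> int. (a 0, (a 1 - a 0) mod n, (a 2 - a 1) mod n)"
  let ?f' = "\<lambda>(z, x, y). \<lambda>i\<in>{..<3::nat}.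
      if i = 0 then z else if i = 1 then (z + x) mod n else (z + x + y) mod n"
  have sys: "n dvd p * x + (- q) * y \<and> n dvd r * x + (q + r) * y \<longleftrightarrow>
      [p * x = q * y] (mod n) \<and> [q * y = r * (- (x + y))] (mod n)" for x y
    by (simp add: cong_iff_dvd_diff algebra_simps)
  have K_iff: "(x, y) \<in> ?K \<longleftrightarrow> x \<in> {0..<n} \<and> y \<in> {0..<n} \<and>
      [p * x = q * y] (mod n) \<and> [q * y = r * (- (x + y))] (mod n)" for x y
    by (simp only: mem_Collect_eq split_conv sys)
  have cap_iff: "a \<in> cap_colorings [p, q, r] n \<longleftrightarrow> a \<in> {..<3} \<rightarrow>\<^sub>E {0..<n} \<and>
      [p * (a 1 - a 0) = q * (a 2 - a 1)] (mod n) \<and> [q * (a 2 - a 1) = r * (a 0 - a 2)] (mod n)" for a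
  proof -
    have "[r * (a 0 - a 2) = p * (a 1 - a 0)] (mod n)"
      if "[p * (a 1 - a 0) = q * (a 2 - a 1)] (mod n)" "[q * (a 2 - a 1) = r * (a 0 - a 2)] (mod n)"
      using that unfolding cong_def by argo
    moreover have "(\<forall>i<length [p, q, r]. \<forall>j. j = Suc i mod length [p, q, r] \<longrightarrow>
          [[p, q, r] ! i * (a j - a i) = [p, q, r] ! j * (a (Suc j mod length [p, q, r]) - a j)] (mod n)) \<longleftrightarrow>
        [p * (a 1 - a 0) = q * (a 2 - a 1)] (mod n) \<and> [q * (a 2 - a 1) = r * (a 0 - a 2)] (mod n) \<and>
        [r * (a 0 - a 2) = p * (a 1 - a 0)] (mod n)"
      by (simp add: All_less_Suc numeral_2_eq_2 conj_ac)
    moreover have "{..<length [p, q, r]} = {..<3}" by simp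
    ultimately show ?thesis unfolding cap_colorings_def mem_Collect_eq by argo
  qed
  have mod_sum3: "(z + x mod n + y mod n) mod n = (z + x + y) mod n" for x y z
    using cong_add[OF cong_add[of z z n "x mod n" x] , of "y mod n" y] by (simp add: cong_def)
  have "bij_betw ?f (cap_colorings [p, q, r] n) ({0..<n} \<times> ?K)"
  proof (rule bij_betw_byWitness[where f' = ?f'])
    show "\<forall>a\<in>cap_colorings [p, q, r] n. ?f' (?f a) = a"
    proof (intro ballI ext)
      fix a and i :: nat assume "a \<in> cap_colorings [p, q, r] n"
      then have a: "a \<in> {..<3} \<rightarrow>\<^sub>E {0..<n}" by (simp add: cap_iff)
      then have "a 1 mod n = a 1" "a 2 mod n = a 2" by (auto simp: PiE_iff)
      then have "(a 0 + (a 1 - a 0) mod n) mod n = a 1"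
        "(a 0 + (a 1 - a 0) mod n + (a 2 - a 1) mod n) mod n = a 2"
        using mod_sum3[of "a 0" "a 1 - a 0" "a 2 - a 1"] by (simp_all add: mod_add_right_eq)
      moreover have "i = 0 \<or> i = 1 \<or> i = 2 \<or> \<not> i < 3" by auto
      ultimately show "?f' (?f a) i = a i"
        using PiE_arb[OF a, of i] by (elim disjE) simp_all
    qed
    show "\<forall>w\<in>{0..<n} \<times> ?K. ?f (?f' w) = w"
      using n by (auto simp: mod_simps)
    show "?f ` cap_colorings [p, q, r] n \<subseteq> {0..<n} \<times> ?K"
    proof (rule image_subsetI)
      fix a assume a: "a \<in> cap_colorings [p, q, r] n"
      have "[- ((a 1 - a 0) mod n + (a 2 - a 1) mod n) = - ((a 1 - a 0) + (a 2 - a 1))] (mod n)"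
        by (simp only: cong_minus_minus_iff) (intro cong_add; simp)
      also have "- ((a 1 - a 0) + (a 2 - a 1)) = a 0 - a 2" by simp
      finally have "[- ((a 1 - a 0) mod n + (a 2 - a 1) mod n) = a 0 - a 2] (mod n)" .
      from cong_scalar_left[OF this, of r]
      have "[p * ((a 1 - a 0) mod n) = q * ((a 2 - a 1) mod n)] (mod n)"
        "[q * ((a 2 - a 1) mod n) = r * (- ((a 1 - a 0) mod n + (a 2 - a 1) mod n))] (mod n)"
        using a unfolding cap_iff cong_def mod_mult_right_eq by argo+
      then have "((a 1 - a 0) mod n, (a 2 - a 1) mod n) \<in> ?K"
        unfolding K_iff using n by simp
      moreover have "a 0 \<in> {0..<n}"
        using a unfolding cap_iff by (metis PiE_mem lessThan_iff zero_less_numeral)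
      ultimately show "?f a \<in> {0..<n} \<times> ?K" by (simp only: mem_Times_iff fst_conv snd_conv)
    qed
    show "?f' ` ({0..<n} \<times> ?K) \<subseteq> cap_colorings [p, q, r] n"
    proof (rule image_subsetI)
      fix w assume wK: "w \<in> {0..<n} \<times> ?K"
      obtain z x y where w: "w = (z, x, y)" by (cases w)
      have z: "z \<in> {0..<n}" and "(x, y) \<in> ?K"
        using wK unfolding w by (simp_all only: mem_Times_iff fst_conv snd_conv)
      then have xy: "[p * x = q * y] (mod n)" "[q * y = r * (- (x + y))] (mod n)"
        unfolding K_iff by blast+
      define a where "a = ?f' w"
      have a: "a 0 = z" "a 1 = (z + x) mod n" "a 2 = (z + x + y) mod n"
        by (simp_all add: a_def w)
      have "[a 1 - a 0 = x] (mod n)" "[a 2 - a 1 = y] (mod n)" "[a 0 - a 2 = - (x + y)] (mod n)"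
        unfolding a by (simp_all add: cong_def mod_simps)
      from cong_scalar_left[OF this(1), of p] cong_scalar_left[OF this(2), of q]
        cong_scalar_left[OF this(3), of r]
      have "[p * (a 1 - a 0) = q * (a 2 - a 1)] (mod n)" "[q * (a 2 - a 1) = r * (a 0 - a 2)] (mod n)"
        using xy unfolding cong_def by argo+
      moreover have "a \<in> {..<3} \<rightarrow>\<^sub>E {0..<n}"
        using n z by (auto simp: a_def w)
      ultimately show "?f' w \<in> cap_colorings [p, q, r] n"
        by (simp add: cap_iff flip: a_def)
    qed
  qed
  then show ?thesis
    using n by (simp add: bij_betw_same_card card_cartesian_product)
qed

theorem corollary22:
  fixes p1 p2 p3 n P Q D1 D2 :: int
    and h :: bool and down :: "pedge \<Rightarrow> bool"
  assumes "p1 > 0" and "p2 > 0" and "p3 > 0" and "n > 0"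
    and "pretzel_orientation [p1, p2, - p3] down"
  defines "P \<equiv> p1 * p2 - p1 * p3 - p2 * p3"
    and "Q \<equiv> gcd p1 (gcd p2 p3)"
    and "D1 \<equiv> gcd Q n"
    and "D2 \<equiv> gcd (\<bar>P\<bar> div Q) n"
  shows "int (card (quandle_Hom (fundamental_quandle (pretzel_diagram h [p1, p2, - p3] down))
                      (dihedral_quandle n)))
         = (if gcd P n = 1 then n else D1 * D2 * n)"
proof -
  have "Q > 0" using \<open>p1 > 0\<close> by (simp add: Q_def)
  \<comment> \<open>every summand of \<open>P\<close> is a product of two multiples of \<open>Q\<close>\<close>
  have "Q * Q dvd \<bar>P\<bar>"
  proof -
    have "Q * Q dvd p1 * p2" "Q * Q dvd p1 * p3" "Q * Q dvd p2 * p3"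
      unfolding Q_def by (intro mult_dvd_mono; meson dvd_refl dvd_trans gcd_dvd1 gcd_dvd2)+
    then show ?thesis by (simp add: P_def)
  qed
  then obtain k where k: "\<bar>P\<bar> = Q * (Q * k)" by (metis dvdE mult.assoc)
  then have factor: "\<bar>P\<bar> div Q = Q * k" using \<open>Q > 0\<close> by simp
  have "int (card (quandle_Hom (fundamental_quandle (pretzel_diagram h [p1, p2, - p3] down))
                      (dihedral_quandle n))) = int (card (cap_colorings [p1, p2, - p3] n))"
    using card_pretzel_colorings[OF \<open>n > 0\<close>]
    by (simp add: card_Hom_fundamental_quandle quandle_dihedral diagram_wf_pretzel)
  also have "\<dots> = n * gcd (p1 * (p2 - p3) - p2 * p3)
      (gcd (n * gcd (gcd p1 (- p2)) (gcd (- p3) (p2 - p3))) (n * n))"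
    using card_homogeneous_system[OF \<open>n > 0\<close>, of p1 "- p2" "- p3" "p2 - p3"] \<open>n > 0\<close>
    by (simp add: card_cap_colorings_3)
  also have "p1 * (p2 - p3) - p2 * p3 = P"
    by (simp add: P_def algebra_simps)
  also have "gcd (gcd p1 (- p2)) (gcd (- p3) (p2 - p3)) = Q"
  proof (rule eq_if_same_divisors)
    show "k dvd gcd (gcd p1 (- p2)) (gcd (- p3) (p2 - p3)) \<longleftrightarrow> k dvd Q" for k
      by (auto simp: Q_def)
  qed (simp_all add: Q_def)
  also have "gcd P (gcd (n * Q) (n * n)) = D1 * D2"
    using gcd_invariant_factors[of Q "Q * k" n] by (simp add: D1_def D2_def factor flip: k)
  finally have main: "int (card (quandle_Hom (fundamental_quandle (pretzel_diagram h [p1, p2, - p3] down))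
                      (dihedral_quandle n))) = D1 * D2 * n"
    by (simp add: ac_simps)
  have "D1 * D2 = 1" if "gcd P n = 1"
  proof -
    have "D1 dvd gcd P n" "D2 dvd gcd P n"
      unfolding D1_def D2_def factor
      by (metis k dvd_abs_iff dvd_trans dvd_triv_left gcd_dvd1 gcd_dvd2 gcd_greatest dvd_triv_right)+
    then show ?thesis using that
      by (simp add: D1_def D2_def)
  qed
  with main show ?thesis by simp
qed

end
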